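(* Let $H_R:\mathcal{L}_2^n\rightrightarrows\mathcal{L}_2^n$ be the reset system $$\begin{cases}\dot x(t)=Ax(t)+Bu(t), & \text{if }\xi(t)\in\mathcal{F},\\ x(t^+)=Rx(t), & \text{if }\xi(t)\in\mathcal{J},\\ y(t)=Cx(t)+Du(t),\end{cases}$$ with $x(0)=0$, $x(t)\in\mathbb{R}^m$, $u(t),y(t)\in\mathbb{R}^n$, $\xi(t)=[x(t)^\top,u(t)^\top]^\top$, $R\in\mathbb{R}^{m\times m}$, and, for some $M\in\mathbb{S}^{m+n}$, $\mathcal{F}=\{\mu\in\mathbb{R}^{m+n}\mid\mu^\top M\mu\ge0\}$ and $\mathcal{J}=\{\mu\in\mathbb{R}^{m+n}\mid\mu^\top M\mu\le0\}$. Let $\mathcal{U}\subset\mathcal{L}_2^n$ be the set of inputs considered, subject to the standing assumptions listed in the context. Let $\Pi\in\mathbb{S}^2$ and $$\Theta(\Pi)=\begin{bmatrix} C & D\\ 0 & I\end{bmatrix}^\top(\Pi\otimes I_n)\begin{bmatrix} C & D\\ 0 & I\end{bmatrix}.$$ Suppose there exist $\tau_1,\tau_2\ge0$ and $P\in\mathbb{S}^m$ such that $$\begin{bmatrix} A & B\\ I & 0\end{bmatrix}^\top\begin{bmatrix}0&P\\P&0\end{bmatrix}\begin{bmatrix} A & B\\ I & 0\end{bmatrix}-\Theta(\Pi)+\tau_1M\preceq0,$$ $$\begin{bmatrix}R^\top PR-P&0\\0&0\end{bmatrix}-\tau_2M\preceq0.$$ Then $\mathrm{SG}_{\mathcal{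U}}(H_R)\subseteq\mathcal{S}(\Pi)$.
   Context: $\mathbb{S}^k$ is the set of real symmetric $k\times k$ matrices; $\preceq0$ means negative semidefinite; $\otimes$ is the Kronecker product. $\mathcal{L}_2^n$ is the space of square-integrable functions $u:\mathbb{R}_{\ge0}\to\mathbb{R}^n$ with $\langle u,y\rangle=\int_0^\infty u(t)^\top y(t)\,dt$ and $\|u\|=\sqrt{\langle u,u\rangle}$. $x(t^+)=\lim_{s\downarrow t}x(s)$. Standing assumptions: for inputs $u\in\mathcal{U}$, solutions of the reset system are well defined for all $t\ge0$, resets occur at isolated points in time (between resets the state flows according to the differential equation with $\xi(t)\in\mathcal{F}$), and $u\in\mathcal{U}$ leads to $x,y\in\mathcal{L}_2$. Moreover $H_R(0)=0$. $H_R(u)$ denotes the set of all output trajectories $y$ corresponding to the input $u$. Scaled graph: for $u\neq0$ and $y\in H_R(u)$, put $\rho(u,y)=\|y\|/\|u\|$ and $\theta(u,y)=\arccos\frac{\langle u,y\rangle}{\|u\|\|y\|}\in[0,\pi]$ if $y\ne0$, $\theta(u,y)=0$ if $y=0$. Then $$\mathrm{SG}_{\mathcal{U}}(H_R)=\{\rho(u,y)e^{\pm j\theta(u,y)}\mid u\in\mathcal{U}\setminus\{0\},\ y\in H_R(u)\}\subset\mathbb{C}$$ (both signs are included). For $\Pi\in\mathbb{S}^2$, $\mathcal{S}(\Pi)=\left\{z\in\mathbb{C}\;\middle|\;\begin{bmatrix}z\\1\end{bmatrix}^*\Pi\begin{bmatrix}z\\1\end{bmatrix}\ge0\right\}$,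 where $*$ is conjugate transpose. *)

theory Defs
  imports "HOL-Analysis.Analysis"
begin

text \<open>Block vectors and block matrices are indexed by sum types: \<open>Inl\<close> is the first block,
  \<open>Inr\<close> the second.\<close>

definition block_vec :: "real ^ 'a \<Rightarrow> real ^ 'b \<Rightarrow> real ^ ('a + 'b)" where
  "block_vec v w = (\<chi> i. case i of Inl a \<Rightarrow> v $ a | Inr b \<Rightarrow> w $ b)"

definition block_mat ::
  "real ^ 'c ^ 'a \<Rightarrow> real ^ 'd ^ 'a \<Rightarrow> real ^ 'c ^ 'b \<Rightarrow> real ^ 'd ^ 'b \<Rightarrow> real ^ ('c + 'd) ^ ('a + 'b)"
  where
  "block_mat X Y Z W = (\<chi> i j.
     case i of
       Inl a \<Rightarrow> (case j of Inl c \<Rightarrow> X $ a $ c | Inr d \<Rightarrow> Y $ a $ d)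
     | Inr b \<Rightarrow> (case j of Inl c \<Rightarrow> Z $ b $ c | Inr d \<Rightarrow> W $ b $ d))"

definition kronecker ::
  "real ^ 'b ^ 'a \<Rightarrow> real ^ 'd ^ 'c \<Rightarrow> real ^ ('b \<times> 'd) ^ ('a \<times> 'c)" where
  "kronecker X Y = (\<chi> p q. X $ fst p $ fst q * Y $ snd p $ snd q)"

text \<open>The Kronecker product of a $2 \times 2$ and an $n \times n$ matrix has its rows and columns
  indexed by pairs. To multiply it with matrices consisting of two blocks of $n$ rows, the first
  block is identified with the pairs \<open>(1, i)\<close> and the second with the pairs \<open>(2, i)\<close>.\<close>

definition block_index :: "'n + 'n \<Rightarrow> 2 \<times> 'n" where
  "block_index k = (case k of Inl i \<Rightarrow> (1, i) | Inr i \<Rightarrow> (2, i))"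

definition kronecker_block ::
  "real ^ 2 ^ 2 \<Rightarrow> real ^ 'n ^ 'n \<Rightarrow> real ^ ('n + 'n) ^ ('n + 'n)" where
  "kronecker_block X Y = (\<chi> i j. kronecker X Y $ block_index i $ block_index j)"

definition symmetric_matrix :: "real ^ 'k ^ 'k \<Rightarrow> bool" where
  "symmetric_matrix X \<longleftrightarrow> transpose X = X"

definition neg_semidef :: "real ^ 'k ^ 'k \<Rightarrow> bool" where
  "neg_semidef X \<longleftrightarrow> symmetric_matrix X \<and> (\<forall>v. v \<bullet> (X *v v) \<le> 0)"


text \<open>Signals are functions on \<open>real\<close> of which only the values at times \<open>t \<ge> 0\<close> matter. They are
  not identified when equal almost everywhere, because the reset law refers to point values;
  being zero as an element of $L_2$ is the predicate \<open>L2_zero\<close>.\<close>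

abbreviation half_line :: "real measure" where
  "half_line \<equiv> lebesgue_on {0..}"

definition L2_signals :: "(real \<Rightarrow> real ^ 'k) set" where
  "L2_signals = {u \<in> borel_measurable half_line. integrable half_line (\<lambda>t. (norm (u t))\<^sup>2)}"

definition L2_zero :: "(real \<Rightarrow> real ^ 'k) \<Rightarrow> bool" where
  "L2_zero u \<longleftrightarrow> (AE t in half_line. u t = 0)"

definition L2_inner :: "(real \<Rightarrow> real ^ 'k) \<Rightarrow> (real \<Rightarrow> real ^ 'k) \<Rightarrow> real" where
  "L2_inner u y = (LINT t|half_line. u t \<bullet> y t)"

definition L2_norm :: "(real \<Rightarrow> real ^ 'k) \<Rightarrow> real" where
  "L2_norm u = sqrt (L2_inner u u)"


definition abs_continuous_on :: "real set \<Rightarrow> (real \<Rightarrow> 'a::real_normed_vector) \<Rightarrow> bool" where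
  "abs_continuous_on S f \<longleftrightarrow>
     (\<forall>\<epsilon>>0. \<exists>\<delta>>0. \<forall>\<D>. \<D> division_of \<Union>\<D> \<and> \<Union>\<D> \<subseteq> S \<and> (\<Sum>K\<in>\<D>. measure lborel K) < \<delta> \<longrightarrow>
        (\<Sum>K\<in>\<D>. norm (f (Sup K) - f (Inf K))) < \<epsilon>)"

definition flow_set :: "real ^ 'k ^ 'k \<Rightarrow> (real ^ 'k) set" where
  "flow_set M = {\<mu>. \<mu> \<bullet> (M *v \<mu>) \<ge> 0}"

definition jump_set :: "real ^ 'k ^ 'k \<Rightarrow> (real ^ 'k) set" where
  "jump_set M = {\<mu>. \<mu> \<bullet> (M *v \<mu>) \<le> 0}"

text \<open>\<open>T\<close> is the set of reset times, without accumulation points. At a reset time \<open>t\<close> the value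
  \<open>x t\<close> is the state before the reset, i.e. \<open>x\<close> is left-continuous. Since inputs are merely
  measurable, the differential equation is meant in the sense of Caratheodory: \<open>x\<close> is absolutely
  continuous between resets and satisfies the equation at almost every time. An interval \<open>{a..b}\<close>
  may end, but not start, at a reset time.\<close>

definition reset_solution ::
  "real ^ 'm ^ 'm \<Rightarrow> real ^ 'n ^ 'm \<Rightarrow> real ^ 'm ^ 'n \<Rightarrow> real ^ 'n ^ 'n \<Rightarrow> real ^ 'm ^ 'm \<Rightarrow>
   real ^ ('m + 'n) ^ ('m + 'n) \<Rightarrow>
   (real \<Rightarrow> real ^ 'n) \<Rightarrow> (real \<Rightarrow> real ^ 'm) \<Rightarrow> (real \<Rightarrow> real ^ 'n) \<Rightarrow> bool" where
  "reset_solution A B C D R M u x y \<longleftrightarrow>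
     x 0 = 0 \<and>
     (\<forall>t\<ge>0. y t = C *v x t + D *v u t) \<and>
     (\<exists>T \<subseteq> {0..}.
        (\<forall>t. finite (T \<inter> {0..t})) \<and>
        (\<forall>t\<in>T. block_vec (x t) (u t) \<in> jump_set M \<and> (x \<longlongrightarrow> R *v x t) (at_right t)) \<and>
        (\<forall>t\<in>{0..} - T. block_vec (x t) (u t) \<in> flow_set M) \<and>
        (\<forall>a b. 0 \<le> a \<and> a \<le> b \<and> {a..<b} \<inter> T = {} \<longrightarrow> abs_continuous_on {a..b} x) \<and>
        (AE t in half_line. t \<notin> T \<longrightarrow> (x has_vector_derivative A *v x t + B *v u t) (at t)))"

definition reset_outputs ::
  "real ^ 'm ^ 'm \<Rightarrow> real ^ 'n ^ 'm \<Rightarrow> real ^ 'm ^ 'n \<Rightarrow> real ^ 'n ^ 'n \<Rightarrow> real ^ 'm ^ 'm \<Rightarrow>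
   real ^ ('m + 'n) ^ ('m + 'n) \<Rightarrow> (real \<Rightarrow> real ^ 'n) \<Rightarrow> (real \<Rightarrow> real ^ 'n) set" where
  "reset_outputs A B C D R M u = {y. \<exists>x. reset_solution A B C D R M u x y}"


definition SG_gain :: "(real \<Rightarrow> real ^ 'n) \<Rightarrow> (real \<Rightarrow> real ^ 'n) \<Rightarrow> real" where
  "SG_gain u y = L2_norm y / L2_norm u"

definition SG_phase :: "(real \<Rightarrow> real ^ 'n) \<Rightarrow> (real \<Rightarrow> real ^ 'n) \<Rightarrow> real" where
  "SG_phase u y =
     (if L2_zero y then 0 else arccos (L2_inner u y / (L2_norm u * L2_norm y)))"

definition scaled_graph ::
  "(real \<Rightarrow> real ^ 'n) set \<Rightarrow> ((real \<Rightarrow> real ^ 'n) \<Rightarrow> (real \<Rightarrow> real ^ 'n) set) \<Rightarrow> complex set" where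
  "scaled_graph U H =
     {of_real (SG_gain u y) * exp (of_real s * \<i> * of_real (SG_phase u y)) |u y s::real.
        u \<in> U \<and> \<not> L2_zero u \<and> y \<in> H u \<and> s \<in> {1, -1}}"

text \<open>The form below is real for symmetric \<open>Q\<close>, so taking the real part loses nothing.\<close>

definition S_region :: "real ^ 2 ^ 2 \<Rightarrow> complex set" where
  "S_region Q = {z. let v = (vector [z, 1] :: complex ^ 2) in
     Re (\<Sum>i\<in>UNIV. \<Sum>j\<in>UNIV. cnj (v $ i) * of_real (Q $ i $ j) * v $ j) \<ge> 0}"

definition Theta_mat ::
  "real ^ 'm ^ 'n \<Rightarrow> real ^ 'n ^ 'n \<Rightarrow> real ^ 2 ^ 2 \<Rightarrow> real ^ ('m + 'n) ^ ('m + 'n)" where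
  "Theta_mat C D Q =
     transpose (block_mat C D 0 (mat 1)) ** kronecker_block Q (mat 1 :: real ^ 'n ^ 'n)
       ** block_mat C D 0 (mat 1)"

end

theory Submission
  imports Defs
begin

text \<open>Use \<open>V x = x \<bullet> P x\<close> as a storage function with supply rate
  \<open>s = q11 |y|^2 + (q12 + q21) u \<bullet> y + q22 |u|^2\<close>. On the flow set the first matrix inequality gives
  \<open>V' \<le> s\<close> almost everywhere, and on the jump set the second one says that resets do not increase
  \<open>V\<close>. As \<open>x 0 = 0\<close>, induction over the finitely many resets before \<open>t\<close> yields
  \<open>V (x t) \<le> integral {0..t} s\<close>. No definiteness of \<open>P\<close> is assumed; instead, since \<open>x\<close> is square integrable,
  \<open>V (x t)\<close> cannot stay below a negative constant, so the total supply is nonnegative. Divided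
  by the squared norm of \<open>u\<close>, this is the inequality that defines \<open>S_region Q\<close>.\<close>

section \<open>The fundamental theorem of calculus for absolutely continuous functions\<close>

text \<open>Absolute continuity is stated for sets of intervals, whereas gauge integration works
  with sets of tagged intervals, so the sums have to be transferred along \<open>snd\<close>. Two
  distinct pairs with the same interval would force that interval to have empty interior, hence to
  be a single point, and both summands vanish on single points.\<close>

lemma abs_continuous_on_tagged_partial:
  assumes "abs_continuous_on S f" and "\<epsilon> > 0"
  obtains \<delta> where "\<delta> > 0"
    and "\<And>p. p tagged_partial_division_of S \<Longrightarrow> (\<Sum>(x,K)\<in>p. measure lborel K) < \<delta>
           \<Longrightarrow> (\<Sum>(x,K)\<in>p. norm (f (Sup K) - f (Inf K))) < \<epsilon>"
proof -
  from assms obtain \<delta> where "\<delta> > 0" and \<delta>: "\<And>\<D>. \<D> division_of \<Union>\<D> \<Longrightarrow> \<Union>\<D> \<subseteq> S \<Longrightarrow>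
      (\<Sum>K\<in>\<D>. measure lborel K) < \<delta> \<Longrightarrow> (\<Sum>K\<in>\<D>. norm (f (Sup K) - f (Inf K))) < \<epsilon>"
    unfolding abs_continuous_on_def by (elim allE[of _ \<epsilon>] impE exE conjE) auto
  have "(\<Sum>(x,K)\<in>p. norm (f (Sup K) - f (Inf K))) < \<epsilon>"
    if p: "p tagged_partial_division_of S" and less: "(\<Sum>(x,K)\<in>p. measure lborel K) < \<delta>" for p
  proof -
    note pD = tagged_partial_division_ofD[OF p]
    have degenerate: "\<exists>c. snd i = {c}" if ij: "i \<in> p" "j \<in> p" "i \<noteq> j" "snd i = snd j" for i j
    proof -
      obtain x K where i: "i = (x, K)" by (cases i)
      obtain u v where K: "K = cbox u v" using pD(4) ij(1) i by blast
      have "x \<in> K" using pD(2) ij(1) i by blast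
      moreover have "interior K = {}"
        using pD(5)[of x K "fst j" K] ij i by (cases j) auto
      ultimately have "K = {x}" using K by auto
      then show ?thesis using i by auto
    qed
    have collapse: "(\<Sum>(x,K)\<in>p. g K) = sum g (snd ` p)" if "\<And>c. g {c} = 0" for g :: "real set \<Rightarrow> real"
    proof -
      have "sum g (snd ` p) = sum (g \<circ> snd) p"
        by (rule sum.reindex_nontrivial) (use pD(1) degenerate that in force)+
      then show ?thesis by (simp add: o_def case_prod_unfold)
    qed
    have "\<Union> (snd ` p) \<subseteq> S" using pD(3) by fastforce
    then show ?thesis
      using \<delta>[OF partial_division_of_tagged_division[OF p]] less by (simp add: collapse)
  qed
  with \<open>\<delta> > 0\<close> that show ?thesis by blast
qed

text \<open>Outer regularity makes \<open>G - N\<close> small, and removing a null set does not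
  change the measure of \<open>G\<close>.\<close>

lemma negligible_open_cover:
  fixes N :: "'a::euclidean_space set"
  assumes "negligible N" and "e > 0"
  obtains G where "open G" "N \<subseteq> G" "G \<in> lmeasurable" "measure lebesgue G < e"
proof -
  have N: "N \<in> null_sets lebesgue"
    using assms negligible_iff_null_sets by blast
  then obtain G where G: "open G" "N \<subseteq> G" "G - N \<in> lmeasurable" "emeasure lebesgue (G - N) < ennreal e"
    using sets_lebesgue_outer_open[of N e] assms(2) by blast
  have "N \<in> lmeasurable" using assms negligible_imp_measurable by blast
  then have Gm: "G \<in> lmeasurable"
    using G(2,3) by (metis Diff_partition fmeasurable.Un)
  have "emeasure lebesgue G = emeasure lebesgue (G - N)"
    using N G(1) by (intro emeasure_Diff_null_set[symmetric]) auto
  with G(4) have "emeasure lebesgue G < ennreal e" by simp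
  then have "measure lebesgue G < e"
    using Gm assms(2) by (simp add: emeasure_eq_measure2 ennreal_less_iff)
  with G Gm that show ?thesis by blast
qed

text \<open>The gauge is built from two kinds of points. Outside \<open>N\<close> the radius comes
  from differentiability, so that the linear approximation has relative error at most
  \<open>c\<close>; on \<open>N\<close> the ball has to stay inside an open set of measure below the
  \<delta> of absolute continuity. Each kind of tag then contributes at most half of the allowed
  error.\<close>

lemma fundamental_theorem_of_calculus_abs_continuous:
  fixes f :: "real \<Rightarrow> 'a::banach"
  assumes "a \<le> b" and ac: "abs_continuous_on {a..b} f" and "negligible N"
    and deriv: "\<And>t. t \<in> {a..b} - N \<Longrightarrow> (f has_vector_derivative f' t) (at t within {a..b})"
  shows "(f' has_integral (f b - f a)) {a..b}"
proof -
  \<comment> \<open>With value 0 on \<open>N\<close>, the Riemann sum gets nothing from tags in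
    \<open>N\<close>, and only the increments of \<open>f\<close> remain to be bounded
    there.\<close>
  define g where "g t = (if t \<in> N then 0 else f' t)" for t
  have "(g has_integral (f b - f a)) (cbox a b)"
    unfolding has_integral
  proof (intro allI impI)
    fix e :: real assume "e > 0"
    \<comment> \<open>This makes \<open>c * (b - a)\<close> at most \<open>e / 4\<close>; the added
      1 keeps the denominator positive when \<open>a = b\<close>.\<close>
    define c where "c = e / 4 / (b - a + 1)"
    have "c > 0" using \<open>a \<le> b\<close> \<open>e > 0\<close> by (simp add: c_def)
    have "e / 2 > 0" using \<open>e > 0\<close> by simp
    obtain \<delta> where "\<delta> > 0" and
      \<delta>: "\<And>p. p tagged_partial_division_of {a..b} \<Longrightarrow> (\<Sum>(x,K)\<in>p. measure lborel K) < \<delta>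
           \<Longrightarrow> (\<Sum>(x,K)\<in>p. norm (f (Sup K) - f (Inf K))) < e / 2"
      using abs_continuous_on_tagged_partial[OF ac \<open>e / 2 > 0\<close>] by blast
    obtain G where G: "open G" "N \<subseteq> G" "G \<in> lmeasurable" "measure lebesgue G < \<delta>"
      using negligible_open_cover[OF \<open>negligible N\<close> \<open>\<delta> > 0\<close>] .
    have "\<forall>t. \<exists>d>0. (t \<in> N \<longrightarrow> ball t d \<subseteq> G) \<and>
        (t \<in> {a..b} - N \<longrightarrow>
          (\<forall>s\<in>{a..b}. norm (s - t) < d \<longrightarrow> norm (f s - f t - (s - t) *\<^sub>R f' t) \<le> c * norm (s - t)))"
    proof
      fix t
      consider "t \<in> N" | "t \<in> {a..b} - N" | "t \<notin> N" "t \<notin> {a..b}" by blast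
      then show "\<exists>d>0. (t \<in> N \<longrightarrow> ball t d \<subseteq> G) \<and>
        (t \<in> {a..b} - N \<longrightarrow>
          (\<forall>s\<in>{a..b}. norm (s - t) < d \<longrightarrow> norm (f s - f t - (s - t) *\<^sub>R f' t) \<le> c * norm (s - t)))"
      proof cases
        case 1
        then show ?thesis using G(1,2) open_contains_ball by blast
      next
        case 2
        then show ?thesis
          using deriv[OF 2] \<open>c > 0\<close>
          unfolding has_vector_derivative_def has_derivative_within_alt by blast
      qed (auto intro: exI[of _ 1])
    qed
    then obtain d where dpos: "\<And>t. d t > 0" and dG: "\<And>t. t \<in> N \<Longrightarrow> ball t (d t) \<subseteq> G"
      and dd: "\<And>t s. t \<in> {a..b} - N \<Longrightarrow> s \<in> {a..b} \<Longrightarrow> norm (s - t) < d t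
                \<Longrightarrow> norm (f s - f t - (s - t) *\<^sub>R f' t) \<le> c * norm (s - t)"
      by metis
    have "norm ((\<Sum>(x,K)\<in>p. measure lborel K *\<^sub>R g x) - (f b - f a)) < e"
      if p: "p tagged_division_of cbox a b" and fine: "(\<lambda>t. ball t (d t)) fine p" for p
    proof -
      note pD = tagged_division_ofD[OF p]
      have part: "p tagged_partial_division_of {a..b}"
        using p unfolding tagged_division_of_def by simp
      define h where "h = (\<lambda>(x,K). measure lborel K *\<^sub>R g x - (f (Sup K) - f (Inf K)))"
      have p': "p tagged_division_of {a..b}" using p by simp
      have split: "p = {i \<in> p. fst i \<in> N} \<union> {i \<in> p. fst i \<notin> N}" by blast
      have "(\<Sum>(x,K)\<in>p. measure lborel K *\<^sub>R g x) - (f b - f a) = sum h p"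
        unfolding h_def case_prod_unfold sum_subtractf
        using additive_tagged_division_1[OF \<open>a \<le> b\<close> p', of f]
        by (simp add: case_prod_unfold sum_subtractf)
      also have "\<dots> = sum h {i \<in> p. fst i \<in> N} + sum h {i \<in> p. fst i \<notin> N}"
        by (subst split, rule sum.union_disjoint) (use pD(1) in auto)
      finally have eq: "(\<Sum>(x,K)\<in>p. measure lborel K *\<^sub>R g x) - (f b - f a)
          = sum h {i \<in> p. fst i \<in> N} + sum h {i \<in> p. fst i \<notin> N}" .
      \<comment> \<open>Intervals tagged in the null set \<open>N\<close> lie in the small open set \<open>G\<close>, so absolute
        continuity controls the increments of \<open>f\<close> over them.\<close>
      have bad: "norm (sum h {i \<in> p. fst i \<in> N}) < e / 2"
      proof -
        let ?p = "{i \<in> p. fst i \<in> N}"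
        have part': "?p tagged_partial_division_of {a..b}"
          by (rule tagged_partial_division_subset[OF part]) auto
        have div: "(snd ` ?p) division_of \<Union>(snd ` ?p)"
          by (rule partial_division_of_tagged_division[OF part'])
        have "(\<Sum>(x,K)\<in>?p. measure lborel K) = sum (measure lborel) (snd ` ?p)"
          by (rule sum.over_tagged_division_lemma
                [OF tagged_partial_division_of_Union_self[OF part']])
             (simp add: content_eq_0_interior)
        also have "\<dots> = measure lebesgue (\<Union>(snd ` ?p))"
        proof -
          have "sum (measure lborel) (snd ` ?p) = (\<Sum>K\<in>snd ` ?p. measure lebesgue K)"
            by (rule sum.cong) (use division_ofD(4)[OF div] in \<open>force simp: measure_completion\<close>)+
          then show ?thesis using content_division[OF div] by simp
        qed
        also have "\<dots> \<le> measure lebesgue G"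
        proof (rule measure_mono_fmeasurable)
          show "\<Union>(snd ` ?p) \<subseteq> G" using fine dG by (fastforce simp: fine_def)
          show "\<Union>(snd ` ?p) \<in> sets lebesgue" using lmeasurable_division[OF div] by auto
        qed (use G in auto)
        finally have "(\<Sum>(x,K)\<in>?p. measure lborel K) < \<delta>" using G(4) by simp
        then have "(\<Sum>(x,K)\<in>?p. norm (f (Sup K) - f (Inf K))) < e / 2" by (rule \<delta>[OF part'])
        moreover have "norm (sum h ?p) \<le> (\<Sum>(x,K)\<in>?p. norm (f (Sup K) - f (Inf K)))"
          by (rule sum_norm_le) (auto simp: h_def g_def norm_minus_commute)
        ultimately show ?thesis by linarith
      qed
      have good: "norm (sum h {i \<in> p. fst i \<notin> N}) \<le> e / 2"
      proof -
        have "norm (h (x,K)) \<le> c * measure lborel K" if "(x,K) \<in> p" "x \<notin> N" for x K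
        proof -
          obtain u v where K: "K = {u..v}" using pD(4) \<open>(x,K) \<in> p\<close> by fastforce
          have x: "x \<in> K" "K \<subseteq> {a..b}" using pD(2,3) \<open>(x,K) \<in> p\<close>
            by (auto simp: box_real(2)[symmetric] simp del: box_real(2))
          then have uv: "u \<le> v" "u \<le> x" "x \<le> v" using K by auto
          have xN: "x \<in> {a..b} - N" using x \<open>x \<notin> N\<close> by auto
          have Kb: "K \<subseteq> ball x (d x)" using fine \<open>(x,K) \<in> p\<close> by (auto simp: fine_def)
          have near: "norm (f s - f x - (s - x) *\<^sub>R f' x) \<le> c * norm (s - x)" if "s \<in> K" for s
            by (rule dd[OF xN]) (use x Kb that in \<open>force simp: dist_real_def\<close>)+
          \<comment> \<open>Straddle argument: both endpoints are compared with the tag between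
            them, and the two errors add up to \<open>c\<close> times the length of the interval
            because \<open>u \<le> x \<le> v\<close>.\<close>
          have "h (x,K) = (f u - f x - (u - x) *\<^sub>R f' x) - (f v - f x - (v - x) *\<^sub>R f' x)"
            using uv \<open>x \<notin> N\<close> by (simp add: h_def g_def K algebra_simps)
          also have "norm \<dots> \<le> c * norm (u - x) + c * norm (v - x)"
            by (rule norm_triangle_le_diff, rule add_mono; rule near) (use uv K in auto)
          also have "\<dots> = c * measure lborel K" using uv by (simp add: K algebra_simps)
          finally show ?thesis .
        qed
        then have "norm (sum h {i \<in> p. fst i \<notin> N}) \<le> (\<Sum>(x,K)\<in>{i \<in> p. fst i \<notin> N}. c * measure lborel K)"
          by (intro sum_norm_le) auto
        also have "\<dots> \<le> (\<Sum>(x,K)\<in>p. c * measure lborel K)"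
          using pD(1) \<open>c > 0\<close> by (intro sum_mono2) auto
        also have "\<dots> = c * (b - a)"
          using additive_content_tagged_division[OF p] \<open>a \<le> b\<close>
          by (simp add: case_prod_unfold sum_distrib_left[symmetric])
        also have "\<dots> \<le> c * (b - a + 1)" using \<open>c > 0\<close> by simp
        also have "\<dots> = e / 4"
          by (subst nonzero_eq_divide_eq[symmetric]) (use \<open>a \<le> b\<close> c_def in auto)
        also have "\<dots> \<le> e / 2" using \<open>e > 0\<close> by simp
        finally show ?thesis .
      qed
      show ?thesis
        unfolding eq using bad good
          norm_triangle_ineq[of "sum h {i \<in> p. fst i \<in> N}" "sum h {i \<in> p. fst i \<notin> N}"]
        by linarith
    qed
    moreover have "gauge (\<lambda>t. ball t (d t))" using dpos by (rule gauge_ball_dependent[rule_format])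
    ultimately show "\<exists>\<gamma>. gauge \<gamma> \<and> (\<forall>\<D>. \<D> tagged_division_of cbox a b \<and> \<gamma> fine \<D> \<longrightarrow>
        norm ((\<Sum>(x,K)\<in>\<D>. measure lborel K *\<^sub>R g x) - (f b - f a)) < e)" by blast
  qed
  then have "(g has_integral (f b - f a)) {a..b}" by simp
  then show ?thesis
    by (rule has_integral_spike[OF \<open>negligible N\<close>, rotated]) (auto simp: g_def)
qed

section \<open>Dissipation along trajectories with jumps\<close>

lemma abs_continuous_on_imp_continuous_on:
  assumes "abs_continuous_on {a..b} f"
  shows "continuous_on {a..b} f"
  unfolding continuous_on_iff
proof (intro ballI allI impI)
  fix s e :: real assume s: "s \<in> {a..b}" and "e > 0"
  from assms \<open>e > 0\<close> obtain d where "d > 0" and d: "\<And>\<D>. \<D> division_of \<Union>\<D> \<and> \<Union>\<D> \<subseteq> {a..b} \<and>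
      (\<Sum>K\<in>\<D>. measure lborel K) < d \<Longrightarrow> (\<Sum>K\<in>\<D>. norm (f (Sup K) - f (Inf K))) < e"
    unfolding abs_continuous_on_def by (elim allE[of _ e] impE exE conjE) auto
  have near: "norm (f v - f u) < e" if "u \<in> {a..b}" "v \<in> {a..b}" "u \<le> v" "v - u < d" for u v
  proof -
    have "{{u..v}} division_of \<Union>{{u..v}}"
      using division_of_self[of u v] that by simp
    then show ?thesis using d[of "{{u..v}}"] that by auto
  qed
  have "dist (f t) (f s) < e" if "t \<in> {a..b}" "dist t s < d" for t
    using near[of s t] near[of t s] s that
    by (cases "s \<le> t") (auto simp: dist_norm norm_minus_commute)
  with \<open>d > 0\<close> show "\<exists>d>0. \<forall>t\<in>{a..b}. dist t s < d \<longrightarrow> dist (f t) (f s) < e" by blast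
qed

lemma abs_continuous_on_lipschitz_compose:
  assumes f: "abs_continuous_on S f" and g: "L-lipschitz_on (f ` S) g"
  shows "abs_continuous_on S (\<lambda>t. g (f t))"
  unfolding abs_continuous_on_def
proof (intro allI impI)
  fix e :: real assume "e > 0"
  have "L \<ge> 0" using g by (rule lipschitz_on_nonneg)
  \<comment> \<open>Dividing by \<open>L + 1\<close> instead of \<open>L\<close> covers the case of
    a constant \<open>g\<close>, where \<open>L\<close> may be 0.\<close>
  then have "e / (L + 1) > 0" using \<open>e > 0\<close> by simp
  with f obtain d where "d > 0" and d: "\<And>\<D>. \<D> division_of \<Union>\<D> \<and> \<Union>\<D> \<subseteq> S \<and>
      (\<Sum>K\<in>\<D>. measure lborel K) < d \<Longrightarrow> (\<Sum>K\<in>\<D>. norm (f (Sup K) - f (Inf K))) < e / (L + 1)"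
    unfolding abs_continuous_on_def by (elim allE[of _ "e / (L + 1)"] impE exE conjE) auto
  have "(\<Sum>K\<in>\<D>. norm (g (f (Sup K)) - g (f (Inf K)))) < e"
    if \<D>: "\<D> division_of \<Union>\<D> \<and> \<Union>\<D> \<subseteq> S \<and> (\<Sum>K\<in>\<D>. measure lborel K) < d" for \<D>
  proof -
    let ?s = "\<Sum>K\<in>\<D>. norm (f (Sup K) - f (Inf K))"
    have "norm (g (f (Sup K)) - g (f (Inf K))) \<le> L * norm (f (Sup K) - f (Inf K))" if KD: "K \<in> \<D>" for K
    proof -
      obtain u v where "K = cbox u v" "K \<noteq> {}"
        using division_ofD(3,4)[OF conjunct1[OF \<D>] KD] by blast
      then have K: "K = {u..v}" "u \<le> v" by auto
      then have "u \<in> K" "v \<in> K" by auto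
      then have "u \<in> S" "v \<in> S" using \<D> KD by auto
      then show ?thesis using lipschitz_onD[OF g, of "f v" "f u"] K by (simp add: dist_norm)
    qed
    then have "(\<Sum>K\<in>\<D>. norm (g (f (Sup K)) - g (f (Inf K)))) \<le> L * ?s"
      unfolding sum_distrib_left by (rule sum_mono)
    also have "\<dots> \<le> (L + 1) * ?s"
      by (simp add: algebra_simps sum_nonneg)
    also have "\<dots> < e"
      using d[OF \<D>] \<open>L \<ge> 0\<close> by (simp add: field_simps)
    finally show ?thesis .
  qed
  with \<open>d > 0\<close> show "\<exists>\<delta>>0. \<forall>\<D>. \<D> division_of \<Union>\<D> \<and> \<Union>\<D> \<subseteq> S \<and> (\<Sum>K\<in>\<D>. measure lborel K) < \<delta> \<longrightarrow>
      (\<Sum>K\<in>\<D>. norm (g (f (Sup K)) - g (f (Inf K)))) < e" by blast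
qed

text \<open>The increment of the form is a bilinear expression in which one argument is changed at a
  time; on a bounded set the unchanged argument is bounded, which leaves a factor
  \<open>norm (p - q)\<close>.\<close>

lemma quadratic_form_lipschitz_on_bounded:
  fixes P :: "real ^ 'k ^ 'k"
  assumes "bounded S"
  obtains L where "L-lipschitz_on S (\<lambda>p. p \<bullet> (P *v p))"
proof -
  obtain B where "B > 0" and B: "\<And>p. p \<in> S \<Longrightarrow> norm p \<le> B"
    using assms bounded_pos by blast
  obtain K where "K > 0" and K: "\<And>p. norm (P *v p) \<le> norm p * K"
    using bounded_linear.pos_bounded[OF matrix_vector_mul_bounded_linear[of P]] by blast
  have "(2 * B * K)-lipschitz_on S (\<lambda>p. p \<bullet> (P *v p))"
  proof (rule lipschitz_onI)
    fix p q assume pq: "p \<in> S" "q \<in> S"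
    have "p \<bullet> (P *v p) - q \<bullet> (P *v q) = (p - q) \<bullet> (P *v p) + q \<bullet> (P *v (p - q))"
      by (simp add: algebra_simps inner_diff_left inner_diff_right matrix_vector_mult_diff_distrib)
    also have "\<bar>\<dots>\<bar> \<le> norm (p - q) * norm (P *v p) + norm q * norm (P *v (p - q))"
      by (intro order_trans[OF abs_triangle_ineq] add_mono Cauchy_Schwarz_ineq2)
    also have "\<dots> \<le> norm (p - q) * (B * K) + B * (norm (p - q) * K)"
      using K[of p] K[of "p - q"] B[OF pq(1)] B[OF pq(2)] \<open>K > 0\<close> \<open>B > 0\<close>
      by (intro add_mono mult_mono order_trans[OF K[of p]] K) (auto intro: mult_right_mono)
    finally show "dist (p \<bullet> (P *v p)) (q \<bullet> (P *v q)) \<le> 2 * B * K * dist p q"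
      by (simp add: dist_norm algebra_simps)
  qed (use \<open>B > 0\<close> \<open>K > 0\<close> in simp)
  with that show ?thesis .
qed

text \<open>A continuous trajectory stays bounded on a compact interval, so only Lipschitz
  continuity on a bounded set is required. This makes the fundamental theorem applicable to the
  storage function.\<close>

lemma abs_continuous_on_quadratic_form:
  fixes x :: "real \<Rightarrow> real ^ 'k"
  assumes "abs_continuous_on {a..b} x"
  shows "abs_continuous_on {a..b} (\<lambda>t. x t \<bullet> (P *v x t))"
proof -
  have "bounded (x ` {a..b})"
    using compact_continuous_image[OF abs_continuous_on_imp_continuous_on[OF assms]]
    by (auto intro: compact_imp_bounded)
  then obtain L where "L-lipschitz_on (x ` {a..b}) (\<lambda>p. p \<bullet> (P *v p))"
    by (rule quadratic_form_lipschitz_on_bounded)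
  with assms show ?thesis by (rule abs_continuous_on_lipschitz_compose)
qed

text \<open>Between jumps the inequality is obtained by integrating the derivative bound.
  \<open>V t\<close> at a jump time is the value before the jump, so the effect of a jump appears as
  a right limit \<open>l\<close>, which does not exceed \<open>V t\<close>. The pieces are then
  glued together by induction on the number of jumps.\<close>

lemma hybrid_dissipation:
  fixes V s :: "real \<Rightarrow> real"
  assumes fin: "\<And>t. finite (T \<inter> {0..t})"
    and ac: "\<And>a b. 0 \<le> a \<Longrightarrow> a \<le> b \<Longrightarrow> {a..<b} \<inter> T = {} \<Longrightarrow> abs_continuous_on {a..b} V"
    and flow: "AE t in half_line. t \<notin> T \<longrightarrow> (\<exists>D\<le>s t. (V has_vector_derivative D) (at t))"
    and jump: "\<And>t. t \<in> T \<Longrightarrow> t \<ge> 0 \<Longrightarrow> \<exists>l\<le>V t. (V \<longlongrightarrow> l) (at_right t)"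
    and int: "\<And>t. s integrable_on {0..t}"
    and "t \<ge> 0"
  shows "V t - V 0 \<le> integral {0..t} s"
proof -
  have sub: "s integrable_on {a..b}" if "0 \<le> a" for a b
    using integrable_on_subinterval[OF int[of b], of a b] that by simp
  obtain N where N: "negligible N"
    and deriv: "\<And>t. t \<ge> 0 \<Longrightarrow> t \<notin> N \<Longrightarrow> t \<notin> T \<Longrightarrow> \<exists>D\<le>s t. (V has_vector_derivative D) (at t)"
  proof -
    have "AE t in lebesgue. t \<in> {0..} \<longrightarrow> t \<notin> T \<longrightarrow> (\<exists>D\<le>s t. (V has_vector_derivative D) (at t))"
      using flow by (subst (asm) AE_restrict_space_iff) auto
    then obtain N where "N \<in> null_sets lebesgue"
      "{t \<in> space lebesgue. \<not> (t \<in> {0..} \<longrightarrow> t \<notin> T \<longrightarrow> (\<exists>D\<le>s t. (V has_vector_derivative D) (at t)))} \<subseteq> N"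
      by (auto simp: eventually_ae_filter)
    then show ?thesis by (intro that[of N]) (auto simp: negligible_iff_null_sets)
  qed
  have regular: "V b - V a \<le> integral {a..b} s"
    if "0 \<le> a" "a \<le> b" "{a..<b} \<inter> T = {}" for a b
  proof -
    \<comment> \<open>The right endpoint may be a jump time, where no derivative is available, so it
      joins the null set. On this set \<open>f\<close> takes the value \<open>s t\<close>, which
      keeps \<open>f\<close> below \<open>s\<close> on the whole interval.\<close>
    define N' where "N' = insert b N"
    define f where "f t = (if t \<in> N' then s t else SOME D. D \<le> s t \<and> (V has_vector_derivative D) (at t))" for t
    have f: "f t \<le> s t \<and> (V has_vector_derivative f t) (at t)" if "t \<in> {a..b} - N'" for t
      unfolding f_def using someI_ex[OF deriv[of t, unfolded Bex_def]] \<open>0 \<le> a\<close> \<open>{a..<b} \<inter> T = {}\<close> that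
      by (force simp: N'_def)
    have "(f has_integral (V b - V a)) {a..b}"
      by (rule fundamental_theorem_of_calculus_abs_continuous[where N = N'])
         (use that ac N f in \<open>auto simp: N'_def intro: has_vector_derivative_at_within\<close>)
    then show ?thesis
    proof (rule has_integral_le[OF _ integrable_integral[OF sub[OF \<open>0 \<le> a\<close>]]])
      fix t assume "t \<in> {a..b}"
      then show "f t \<le> s t"
        using f[of t] by (cases "t \<in> N'") (auto simp: f_def)
    qed
  qed
  have after_jump: "V b - V a \<le> integral {a..b} s"
    if ab: "0 \<le> a" "a \<le> b" "{a<..<b} \<inter> T = {}" for a b
  proof (cases "a \<in> T \<and> a < b")
    case False
    show ?thesis
    proof (cases "a = b")
      case eq: False
      then have "{a..<b} = insert a {a<..<b}" using ab by auto
      then show ?thesis using regular ab False eq by auto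
    qed simp
  next
    case True
    then obtain l where "l \<le> V a" and l: "(V \<longlongrightarrow> l) (at_right a)" using jump \<open>0 \<le> a\<close> by blast
    \<comment> \<open>The interval without its left endpoint is free of jumps:
      \<open>regular\<close> applies to \<open>{c..b}\<close> for every \<open>c\<close> strictly
      between \<open>a\<close> and \<open>b\<close>, and \<open>c\<close> tends to \<open>a\<close>
      from the right.\<close>
    have "V b - l \<le> integral {a..b} s"
    proof (rule tendsto_le[OF trivial_limit_at_right_real])
      show "((\<lambda>c. V b - V c) \<longlongrightarrow> V b - l) (at_right a)" by (intro tendsto_intros l)
      have "continuous_on {a..b} (\<lambda>c. integral {c..b} s)"
        by (rule indefinite_integral_continuous_1'[OF sub[OF \<open>0 \<le> a\<close>]])
      then show "((\<lambda>c. integral {c..b} s) \<longlongrightarrow> integral {a..b} s) (at_right a)"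
        using continuous_on_Icc_at_rightD[of a b "\<lambda>c. integral {c..b} s"] True by simp
      have "\<forall>\<^sub>F c in at_right a. c \<in> {a<..<b}"
        using True by (intro eventually_at_right_real) auto
      then show "\<forall>\<^sub>F c in at_right a. V b - V c \<le> integral {c..b} s"
      proof (rule eventually_mono)
        fix c assume c: "c \<in> {a<..<b}"
        then have "{c..<b} \<subseteq> {a<..<b}" by auto
        with c ab show "V b - V c \<le> integral {c..b} s" by (intro regular) auto
      qed
    qed
    with \<open>l \<le> V a\<close> show ?thesis by linarith
  qed
  show ?thesis
    using \<open>t \<ge> 0\<close>
  \<comment> \<open>Only jumps strictly between 0 and \<open>t\<close> are counted: a jump at 0 is
    covered by \<open>after_jump\<close>, and one at \<open>t\<close> has not yet affected
    \<open>V t\<close>.\<close>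
  proof (induction "card (T \<inter> {0<..<t})" arbitrary: t rule: less_induct)
    case less
    have fin': "finite (T \<inter> {0<..<c})" for c by (rule finite_subset[OF _ fin[of c]]) auto
    show ?case
    proof (cases "T \<inter> {0<..<t} = {}")
      case True
      then show ?thesis using after_jump[of 0 t] less.prems by auto
    next
      case False
      \<comment> \<open>Splitting at the last jump before \<open>t\<close> leaves fewer jumps in
        front of \<open>r\<close> and none strictly between \<open>r\<close> and
        \<open>t\<close>.\<close>
      define r where "r = Max (T \<inter> {0<..<t})"
      have r: "r \<in> T \<inter> {0<..<t}" unfolding r_def by (rule Max_in[OF fin' False])
      have max: "q \<le> r" if "q \<in> T \<inter> {0<..<t}" for q
        unfolding r_def by (rule Max_ge[OF fin' that])
      have "T \<inter> {0<..<r} \<subset> T \<inter> {0<..<t}" using r by auto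
      then have "V r - V 0 \<le> integral {0..r} s"
        using r by (intro less.hyps psubset_card_mono fin') auto
      moreover have "V t - V r \<le> integral {r..t} s"
        by (rule after_jump) (use r max in force)+
      moreover have "integral {0..r} s + integral {r..t} s = integral {0..t} s"
        using r by (intro Henstock_Kurzweil_Integration.integral_combine int) auto
      ultimately show ?thesis by linarith
    qed
  qed
qed

section \<open>Square-integrable signals and scaled graphs\<close>

lemma L2_inner_integrable:
  assumes "u \<in> L2_signals" "y \<in> L2_signals"
  shows "integrable half_line (\<lambda>t. u t \<bullet> y t)"
proof (rule Bochner_Integration.integrable_bound)
  show "integrable half_line (\<lambda>t. (norm (u t))\<^sup>2 + (norm (y t))\<^sup>2)"
    using assms by (auto simp: L2_signals_def)
  show "(\<lambda>t. u t \<bullet> y t) \<in> borel_measurable half_line"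
    using assms by (auto simp: L2_signals_def intro: borel_measurable_inner)
  have "\<bar>u t \<bullet> y t\<bar> \<le> (norm (u t))\<^sup>2 + (norm (y t))\<^sup>2" for t
  proof -
    have "2 * (norm (u t) * norm (y t)) \<le> (norm (u t))\<^sup>2 + (norm (y t))\<^sup>2"
      using sum_squares_bound[of "norm (u t)" "norm (y t)"] by simp
    moreover have "0 \<le> norm (u t) * norm (y t)" by simp
    ultimately show ?thesis using Cauchy_Schwarz_ineq2[of "u t" "y t"] by linarith
  qed
  then show "AE t in half_line. norm (u t \<bullet> y t) \<le> norm ((norm (u t))\<^sup>2 + (norm (y t))\<^sup>2)"
    by auto
qed

lemma L2_inner_self_nonneg: "L2_inner u u \<ge> 0"
  by (simp add: L2_inner_def)

lemma power2_L2_norm: "(L2_norm u)\<^sup>2 = L2_inner u u"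
  by (simp add: L2_norm_def L2_inner_self_nonneg)

lemma L2_norm_nonneg: "L2_norm u \<ge> 0"
  by (simp add: L2_norm_def L2_inner_self_nonneg)

lemma L2_norm_eq_0_iff:
  assumes "u \<in> L2_signals"
  shows "L2_norm u = 0 \<longleftrightarrow> L2_zero u"
proof -
  have "L2_inner u u = 0 \<longleftrightarrow> (AE t in half_line. u t \<bullet> u t = 0)"
    unfolding L2_inner_def
    by (rule integral_nonneg_eq_0_iff_AE[OF L2_inner_integrable[OF assms assms]]) simp
  then show ?thesis by (simp add: L2_norm_def L2_zero_def)
qed

lemma L2_inner_zero_right:
  assumes "L2_zero y" shows "L2_inner u y = 0"
  unfolding L2_inner_def
  by (rule integral_eq_zero_AE) (use assms in \<open>auto simp: L2_zero_def elim: eventually_mono\<close>)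

text \<open>The classical argument, carried out with functions not identified almost everywhere: the
  residual of \<open>u\<close> after projection onto \<open>y\<close> has nonnegative squared
  norm.\<close>

lemma L2_Cauchy_Schwarz:
  assumes u: "u \<in> L2_signals" and y: "y \<in> L2_signals"
  shows "\<bar>L2_inner u y\<bar> \<le> L2_norm u * L2_norm y"
proof (cases "L2_norm y = 0")
  case True
  then show ?thesis using L2_norm_eq_0_iff[OF y] L2_inner_zero_right by simp
next
  case False
  then have pos: "L2_inner y y > 0"
    using power2_L2_norm[of y] by (metis zero_less_power2)
  note [simp] = L2_inner_integrable[OF u u] L2_inner_integrable[OF u y] L2_inner_integrable[OF y y]
  \<comment> \<open>The coefficient of the orthogonal projection of \<open>u\<close> onto
    \<open>y\<close>.\<close>
  define c where "c = L2_inner u y / L2_inner y y"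
  have "0 \<le> (LINT t|half_line. (u t - c *\<^sub>R y t) \<bullet> (u t - c *\<^sub>R y t))"
    by (rule Bochner_Integration.integral_nonneg) simp
  also have "\<dots> = (LINT t|half_line. (u t \<bullet> u t - 2 * c * (u t \<bullet> y t)) + c\<^sup>2 * (y t \<bullet> y t))"
    by (rule Bochner_Integration.integral_cong)
       (simp_all add: inner_diff_left inner_diff_right inner_commute power2_eq_square algebra_simps)
  also have "\<dots> = L2_inner u u - 2 * c * L2_inner u y + c\<^sup>2 * L2_inner y y"
    by (simp add: L2_inner_def)
  also have "\<dots> = L2_inner u u - (L2_inner u y)\<^sup>2 / L2_inner y y"
    using pos by (simp add: c_def field_simps power2_eq_square)
  finally have "(L2_inner u y)\<^sup>2 \<le> (L2_norm u * L2_norm y)\<^sup>2"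
    using pos by (simp add: power2_L2_norm power_mult_distrib field_simps)
  then show ?thesis
    by (simp add: abs_le_square_iff[symmetric] L2_norm_nonneg)
qed

section \<open>From an integral quadratic inequality to the scaled graph\<close>

lemma S_region_iff:
  "z \<in> S_region Q \<longleftrightarrow>
     Q $ 1 $ 1 * (cmod z)\<^sup>2 + (Q $ 1 $ 2 + Q $ 2 $ 1) * Re z + Q $ 2 $ 2 \<ge> 0"
proof -
  have "Re (\<Sum>i\<in>UNIV. \<Sum>j\<in>UNIV. cnj ((vector [z, 1] :: complex ^ 2) $ i) * of_real (Q $ i $ j) *
          (vector [z, 1] :: complex ^ 2) $ j)
      = Q $ 1 $ 1 * (cmod z)\<^sup>2 + (Q $ 1 $ 2 + Q $ 2 $ 1) * Re z + Q $ 2 $ 2"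
    by (simp add: sum_2 cmod_power2) (simp add: power2_eq_square algebra_simps)
  then show ?thesis by (simp add: S_region_def Let_def)
qed

text \<open>After multiplication by the squared norm of \<open>u\<close>, the squared modulus of
  \<open>z\<close> becomes \<open>L2_inner y y\<close> and its real part becomes
  \<open>L2_inner u y\<close>; the inequality defining the region turns into
  \<open>IQC\<close>.\<close>

lemma scaled_graph_subset_S_region:
  fixes Q :: "real ^ 2 ^ 2"
  assumes L2: "\<And>u y. u \<in> U \<Longrightarrow> y \<in> H u \<Longrightarrow> u \<in> L2_signals \<and> y \<in> L2_signals"
    and IQC: "\<And>u y. u \<in> U \<Longrightarrow> y \<in> H u \<Longrightarrow>
      Q $ 1 $ 1 * L2_inner y y + (Q $ 1 $ 2 + Q $ 2 $ 1) * L2_inner u y + Q $ 2 $ 2 * L2_inner u u \<ge> 0"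
  shows "scaled_graph U H \<subseteq> S_region Q"
proof
  fix z assume "z \<in> scaled_graph U H"
  then obtain u y and s :: real where uy: "u \<in> U" "\<not> L2_zero u" "y \<in> H u" and s: "s \<in> {1, -1}"
    and z: "z = of_real (SG_gain u y) * exp (of_real s * \<i> * of_real (SG_phase u y))"
    unfolding scaled_graph_def by blast
  have u: "u \<in> L2_signals" and y: "y \<in> L2_signals" using L2 uy by blast+
  have upos: "L2_norm u > 0"
    using L2_norm_eq_0_iff[OF u] uy(2) L2_norm_nonneg[of u] by linarith
  have gain: "SG_gain u y \<ge> 0" by (simp add: SG_gain_def L2_norm_nonneg)
  have "z = of_real (SG_gain u y) * cis (s * SG_phase u y)"
    by (simp add: z cis_conv_exp mult_ac)
  then have "cmod z = SG_gain u y" and "Re z = SG_gain u y * cos (s * SG_phase u y)"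
    using gain by (simp_all add: norm_mult)
  \<comment> \<open>Cosine is even, so both signs of the phase give the same real part.\<close>
  then have norm_z: "(L2_norm u)\<^sup>2 * (cmod z)\<^sup>2 = L2_inner y y"
    and Re_z: "Re z = SG_gain u y * cos (SG_phase u y)"
    using s upos by (auto simp: SG_gain_def power_divide power2_L2_norm[symmetric])
  have inner_z: "(L2_norm u)\<^sup>2 * Re z = L2_inner u y"
  proof (cases "L2_zero y")
    case True
    then show ?thesis
      using L2_norm_eq_0_iff[OF y] by (simp add: Re_z SG_gain_def L2_inner_zero_right)
  next
    case False
    then have ypos: "L2_norm y > 0"
      using L2_norm_eq_0_iff[OF y] L2_norm_nonneg[of y] by linarith
    \<comment> \<open>Cauchy-Schwarz places the quotient in the domain where cosine inverts
      \<open>arccos\<close>.\<close>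
    have "\<bar>L2_inner u y / (L2_norm u * L2_norm y)\<bar> \<le> 1"
      using L2_Cauchy_Schwarz[OF u y] upos ypos by (simp add: abs_divide abs_mult)
    then have "cos (SG_phase u y) = L2_inner u y / (L2_norm u * L2_norm y)"
      using False by (simp add: SG_phase_def cos_arccos_abs)
    then show ?thesis
      using upos ypos by (simp add: Re_z SG_gain_def power2_eq_square)
  qed
  have "(L2_norm u)\<^sup>2 * (Q $ 1 $ 1 * (cmod z)\<^sup>2 + (Q $ 1 $ 2 + Q $ 2 $ 1) * Re z + Q $ 2 $ 2)
     = Q $ 1 $ 1 * L2_inner y y + (Q $ 1 $ 2 + Q $ 2 $ 1) * L2_inner u y + Q $ 2 $ 2 * L2_inner u u"
    by (simp flip: norm_z inner_z power2_L2_norm[of u]) (simp add: algebra_simps)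
  with IQC[OF uy(1,3)] upos show "z \<in> S_region Q"
    unfolding S_region_iff by (metis zero_le_mult_iff zero_less_power not_le)
qed

section \<open>Integrals over the half-line\<close>

lemma set_integrable_half_line:
  fixes s :: "real \<Rightarrow> real"
  assumes "integrable half_line s"
  shows "set_integrable lebesgue {0..} s"
  using assms by (simp add: set_integrable_def integrable_restrict_space)

text \<open>The bridge between the gauge integrals over \<open>{0..t}\<close> in the dissipation
  inequality and the Lebesgue integral that defines \<open>L2_inner\<close>.\<close>

lemma tendsto_integral_half_line:
  fixes s :: "real \<Rightarrow> real"
  assumes "integrable half_line s"
  shows "((\<lambda>t. integral {0..t} s) \<longlongrightarrow> integral\<^sup>L half_line s) at_top"
proof -
  note s = set_integrable_half_line[OF assms]
  have "((\<lambda>t. set_lebesgue_integral lebesgue {0..t} s) \<longlongrightarrow> set_lebesgue_integral lebesgue {0..} s) at_top"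
    using s by (intro tendsto_set_lebesgue_integral_at_top) auto
  moreover have "set_lebesgue_integral lebesgue {0..t} s = integral {0..t} s" for t
    by (rule set_lebesgue_integral_eq_integral(2), rule set_integrable_subset[OF s]) auto
  moreover have "set_lebesgue_integral lebesgue {0..} s = integral\<^sup>L half_line s"
    by (simp add: set_lebesgue_integral_def integral_restrict_space)
  ultimately show ?thesis by simp
qed

text \<open>The integral up to \<open>t\<close> would grow at least linearly, while integrability
  gives it a finite limit.\<close>

lemma not_integrable_if_eventually_ge:
  fixes f :: "real \<Rightarrow> real"
  assumes "c > 0" and ge: "\<forall>\<^sub>F t in at_top. c \<le> f t"
  shows "\<not> integrable half_line f"
proof
  assume f: "integrable half_line f"
  obtain a where a: "\<And>t. t \<ge> a \<Longrightarrow> c \<le> f t" using ge by (auto simp: eventually_at_top_linorder)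
  define b where "b = max a 0"
  have int: "set_integrable lebesgue {b..} f"
    by (rule set_integrable_subset[OF set_integrable_half_line[OF f]]) (auto simp: b_def)
  have "((\<lambda>t. integral {b..t} f) \<longlongrightarrow> set_lebesgue_integral lebesgue {b..} f) at_top"
  proof -
    have "set_lebesgue_integral lebesgue {b..t} f = integral {b..t} f" for t
      by (rule set_lebesgue_integral_eq_integral(2), rule set_integrable_subset[OF int]) auto
    then show ?thesis
      using tendsto_set_lebesgue_integral_at_top[OF _ int] by simp
  qed
  moreover have "filterlim (\<lambda>t. integral {b..t} f) at_top at_top"
  proof (rule filterlim_at_top_mono)
    show "filterlim (\<lambda>t. c * (t - b)) at_top at_top"
      using \<open>c > 0\<close> by real_asymp
    show "\<forall>\<^sub>F t in at_top. c * (t - b) \<le> integral {b..t} f"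
      using eventually_ge_at_top[of b]
    proof eventually_elim
      case (elim t)
      have "f integrable_on {b..t}"
        by (rule set_lebesgue_integral_eq_integral(1), rule set_integrable_subset[OF int]) auto
      then have "integral {b..t} (\<lambda>_. c) \<le> integral {b..t} f"
        by (intro integral_le) (auto simp: a b_def)
      with elim show ?case by (simp add: mult.commute)
    qed
  qed
  ultimately show False using not_tendsto_and_filterlim_at_infinity[OF trivial_limit_at_top_linorder]
    filterlim_at_top_imp_at_infinity by blast
qed

section \<open>Reset systems\<close>

lemma sum_UNIV_sum_type:
  fixes f :: "'a::finite + 'b::finite \<Rightarrow> 'c::comm_monoid_add"
  shows "sum f UNIV = (\<Sum>i\<in>UNIV. f (Inl i)) + (\<Sum>j\<in>UNIV. f (Inr j))"
  by (simp add: UNIV_Plus_UNIV[symmetric] sum.Plus del: UNIV_Plus_UNIV)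

lemma inner_block_vec: "block_vec p q \<bullet> block_vec p' q' = p \<bullet> p' + q \<bullet> q'"
  by (simp add: inner_vec_def sum_UNIV_sum_type block_vec_def)

lemma block_mat_mult_vec:
  "block_mat X Y Z W *v block_vec p q = block_vec (X *v p + Y *v q) (Z *v p + W *v q)"
  by (auto simp: vec_eq_iff matrix_vector_mult_def sum_UNIV_sum_type block_vec_def block_mat_def
      split: sum.split)

lemma inner_transpose_conjugation:
  fixes X :: "real ^ 'a ^ 'b"
  shows "v \<bullet> ((transpose X ** Y ** X) *v v) = (X *v v) \<bullet> (Y *v (X *v v))"
  by (metis dot_lmul_matrix inner_commute matrix_vector_mul_assoc transpose_matrix_vector)

lemma kronecker_block_mat_1:
  fixes Q :: "real ^ 2 ^ 2"
  shows "kronecker_block Q (mat 1 :: real ^ 'n ^ 'n)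
    = block_mat (mat (Q $ 1 $ 1)) (mat (Q $ 1 $ 2)) (mat (Q $ 2 $ 1)) (mat (Q $ 2 $ 2))"
  by (auto simp: vec_eq_iff kronecker_block_def kronecker_def block_index_def block_mat_def mat_def
      split: sum.split)

lemma mat_mult_vec: "mat c *v (x :: real ^ 'n) = c *\<^sub>R x"
  by (simp add: vec_eq_iff matrix_vector_mult_def mat_def if_distrib[where f = "\<lambda>a. a * _"]
      cong: if_cong)

text \<open>The outer factor of \<open>Theta_mat\<close> sends the pair of state and input to the
  pair of output and input, on which the Kronecker product acts by scalar blocks; the result is the
  supply rate.\<close>

lemma Theta_mat_quadratic_form:
  "block_vec x u \<bullet> (Theta_mat C D Q *v block_vec x u)
   = (let y = C *v x + D *v u in
       Q $ 1 $ 1 * (y \<bullet> y) + (Q $ 1 $ 2 + Q $ 2 $ 1) * (u \<bullet> y) + Q $ 2 $ 2 * (u \<bullet> u))"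
  unfolding Theta_mat_def inner_transpose_conjugation
  by (simp add: kronecker_block_mat_1 block_mat_mult_vec inner_block_vec mat_mult_vec Let_def
      inner_add_right inner_commute algebra_simps)

text \<open>The right-hand side is the derivative of \<open>x \<bullet> (P *v x)\<close> along the
  flow, since the outer factor sends \<open>(x, u)\<close> to the pair of velocity and
  state.\<close>

lemma flow_quadratic_form:
  "block_vec x u \<bullet> ((transpose (block_mat A B (mat 1) 0) ** block_mat 0 P P 0
      ** block_mat A B (mat 1) 0) *v block_vec x u)
   = (A *v x + B *v u) \<bullet> (P *v x) + x \<bullet> (P *v (A *v x + B *v u))"
  unfolding inner_transpose_conjugation
  by (simp add: block_mat_mult_vec inner_block_vec)

lemma jump_quadratic_form:
  "block_vec x u \<bullet> (block_mat (transpose R ** P ** R - P) 0 0 0 *v block_vec x u)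
   = (R *v x) \<bullet> (P *v (R *v x)) - x \<bullet> (P *v x)"
  by (simp add: block_mat_mult_vec inner_block_vec matrix_vector_mult_diff_rdistrib
      inner_diff_right inner_transpose_conjugation)

section \<open>The storage function along solutions of the reset system\<close>

lemma has_vector_derivative_quadratic_form:
  fixes P :: "real ^ 'k ^ 'k"
  assumes "(x has_vector_derivative x') (at t within S)"
  shows "((\<lambda>t. x t \<bullet> (P *v x t)) has_vector_derivative x t \<bullet> (P *v x') + x' \<bullet> (P *v x t)) (at t within S)"
  by (intro bounded_bilinear.has_vector_derivative[OF bounded_bilinear_inner] assms
      bounded_linear.has_vector_derivative[OF matrix_vector_mul_bounded_linear])

text \<open>This is the S-procedure: the multiples of \<open>M\<close> in the matrix inequalities
  have a known sign on the flow set and on the jump set, so each inequality yields its pointwise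
  estimate exactly where the corresponding law is active.\<close>

lemma reset_solution_dissipation:
  fixes A P :: "real ^ 'm ^ 'm" and u y :: "real \<Rightarrow> real ^ 'n" and Q :: "real ^ 2 ^ 2"
  defines "V \<equiv> \<lambda>p. p \<bullet> (P *v p)"
    and "s \<equiv> \<lambda>t. Q $ 1 $ 1 * (y t \<bullet> y t) + (Q $ 1 $ 2 + Q $ 2 $ 1) * (u t \<bullet> y t) + Q $ 2 $ 2 * (u t \<bullet> u t)"
  assumes sol: "reset_solution A B C D R M u x y"
    and "\<tau>\<^sub>1 \<ge> 0" "\<tau>\<^sub>2 \<ge> 0"
    and flow: "neg_semidef
             (transpose (block_mat A B (mat 1) 0) ** block_mat 0 P P 0 ** block_mat A B (mat 1) 0
               - Theta_mat C D Q + \<tau>\<^sub>1 *\<^sub>R M)"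
    and jump: "neg_semidef
             (block_mat (transpose R ** P ** R - P) 0 0 (0 :: real ^ 'n ^ 'n) - \<tau>\<^sub>2 *\<^sub>R M)"
    and int: "\<And>t. s integrable_on {0..t}"
    and "t \<ge> 0"
  shows "V (x t) \<le> integral {0..t} s"
proof -
  from sol have "x 0 = 0" and y: "\<And>t. t \<ge> 0 \<Longrightarrow> y t = C *v x t + D *v u t"
    by (simp_all add: reset_solution_def)
  from sol obtain T where T: "T \<subseteq> {0..}" "\<forall>t. finite (T \<inter> {0..t})"
    and at_T: "\<forall>t\<in>T. block_vec (x t) (u t) \<in> jump_set M \<and> (x \<longlongrightarrow> R *v x t) (at_right t)"
    and off_T: "\<forall>t\<in>{0..} - T. block_vec (x t) (u t) \<in> flow_set M"
    and ac: "\<forall>a b. 0 \<le> a \<and> a \<le> b \<and> {a..<b} \<inter> T = {} \<longrightarrow> abs_continuous_on {a..b} x"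
    and ode: "AE t in half_line. t \<notin> T \<longrightarrow> (x has_vector_derivative A *v x t + B *v u t) (at t)"
    unfolding reset_solution_def by (elim conjE exE) (rule that)
  have jump_le: "V (R *v x t) \<le> V (x t)" if "t \<in> T" for t
  proof -
    let ?w = "block_vec (x t) (u t)"
    have "?w \<bullet> ((block_mat (transpose R ** P ** R - P) 0 0 0 - \<tau>\<^sub>2 *\<^sub>R M) *v ?w) \<le> 0"
      using jump by (simp add: neg_semidef_def)
    then have "V (R *v x t) - V (x t) \<le> \<tau>\<^sub>2 * (?w \<bullet> (M *v ?w))"
      by (simp add: V_def matrix_vector_mult_diff_rdistrib inner_diff_right jump_quadratic_form
          scaleR_matrix_vector_assoc[symmetric])
    also have "\<dots> \<le> 0"
      using at_T that \<open>\<tau>\<^sub>2 \<ge> 0\<close> by (simp add: jump_set_def mult_nonneg_nonpos)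
    finally show ?thesis by simp
  qed
  have flow_le: "x t \<bullet> (P *v (A *v x t + B *v u t)) + (A *v x t + B *v u t) \<bullet> (P *v x t) \<le> s t"
    if "t \<ge> 0" "t \<notin> T" for t
  proof -
    let ?w = "block_vec (x t) (u t)"
    let ?F = "transpose (block_mat A B (mat 1) 0) ** block_mat 0 P P 0 ** block_mat A B (mat 1) 0"
    have "?w \<bullet> ((?F - Theta_mat C D Q + \<tau>\<^sub>1 *\<^sub>R M) *v ?w) \<le> 0"
      using flow by (simp add: neg_semidef_def)
    then have "?w \<bullet> (?F *v ?w) - ?w \<bullet> (Theta_mat C D Q *v ?w) + \<tau>\<^sub>1 * (?w \<bullet> (M *v ?w)) \<le> 0"
      by (simp only: matrix_vector_mult_diff_rdistrib matrix_vector_mult_add_rdistrib inner_diff_right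
          inner_add_right scaleR_matrix_vector_assoc[symmetric] inner_scaleR_right)
    moreover have "\<tau>\<^sub>1 * (?w \<bullet> (M *v ?w)) \<ge> 0"
      using off_T that \<open>\<tau>\<^sub>1 \<ge> 0\<close> by (simp add: flow_set_def)
    moreover have "?w \<bullet> (Theta_mat C D Q *v ?w) = s t"
      by (simp add: Theta_mat_quadratic_form Let_def s_def y[OF \<open>t \<ge> 0\<close>])
    ultimately show ?thesis unfolding flow_quadratic_form by linarith
  qed
  have "V (x t) - V (x 0) \<le> integral {0..t} s"
  proof (rule hybrid_dissipation[where V = "\<lambda>t. V (x t)" and T = T])
    show "abs_continuous_on {a..b} (\<lambda>t. V (x t))"
      if "0 \<le> a" "a \<le> b" "{a..<b} \<inter> T = {}" for a b
      unfolding V_def using ac that by (intro abs_continuous_on_quadratic_form) blast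
    show "AE t in half_line. t \<notin> T \<longrightarrow>
        (\<exists>D\<le>s t. ((\<lambda>t. V (x t)) has_vector_derivative D) (at t))"
    proof (rule AE_mp[OF ode], rule AE_I2, intro impI)
      fix t assume t: "t \<in> space half_line" "t \<notin> T"
        and "t \<notin> T \<longrightarrow> (x has_vector_derivative A *v x t + B *v u t) (at t)"
      then show "\<exists>D\<le>s t. ((\<lambda>t. V (x t)) has_vector_derivative D) (at t)"
        unfolding V_def
        using has_vector_derivative_quadratic_form[of x "A *v x t + B *v u t" t UNIV P] flow_le[of t]
        by (auto simp: space_restrict_space)
    qed
    show "\<exists>l\<le>V (x t). ((\<lambda>t. V (x t)) \<longlongrightarrow> l) (at_right t)" if "t \<in> T" for t
    proof (intro exI conjI)
      show "V (R *v x t) \<le> V (x t)" by (rule jump_le[OF that])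
      show "((\<lambda>t. V (x t)) \<longlongrightarrow> V (R *v x t)) (at_right t)"
        unfolding V_def
        by (intro tendsto_inner bounded_linear.tendsto[OF matrix_vector_mul_bounded_linear])
           (use at_T that in blast)+
    qed
  qed (use T int \<open>t \<ge> 0\<close> in auto)
  then show ?thesis by (simp add: \<open>x 0 = 0\<close> V_def)
qed

text \<open>If \<open>I\<close> were negative, the form would eventually lie below
  \<open>I / 2\<close>. Its absolute value is at most \<open>K\<close> times the squared norm of the
  state, which would then stay above a positive constant and fail to be integrable. This avoids
  having to show that the state tends to 0.\<close>

lemma L2_storage_limit_nonneg:
  fixes x :: "real \<Rightarrow> real ^ 'k"
  assumes x: "x \<in> L2_signals"
    and le: "\<And>t. t \<ge> 0 \<Longrightarrow> x t \<bullet> (P *v x t) \<le> J t"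
    and J: "(J \<longlongrightarrow> I) at_top"
  shows "I \<ge> 0"
proof (rule ccontr)
  assume "\<not> I \<ge> 0"
  then have "I < I / 2" by simp
  obtain K where "K > 0" and K: "\<And>p. norm (P *v p) \<le> norm p * K"
    using bounded_linear.pos_bounded[OF matrix_vector_mul_bounded_linear[of P]] by blast
  have "\<forall>\<^sub>F t in at_top. - I / 2 \<le> K * (norm (x t))\<^sup>2"
    using order_tendstoD(2)[OF J \<open>I < I / 2\<close>] eventually_ge_at_top[of 0]
  proof eventually_elim
    case (elim t)
    have "- (x t \<bullet> (P *v x t)) \<le> norm (x t) * norm (P *v x t)"
      using Cauchy_Schwarz_ineq2[of "x t" "P *v x t"] by linarith
    also have "\<dots> \<le> norm (x t) * (norm (x t) * K)" by (intro mult_left_mono K) simp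
    finally show ?case using le[of t] elim by (simp add: power2_eq_square mult_ac)
  qed
  moreover have "integrable half_line (\<lambda>t. K * (norm (x t))\<^sup>2)"
    using x by (simp add: L2_signals_def)
  ultimately show False
    using not_integrable_if_eventually_ge[of "- I / 2" "\<lambda>t. K * (norm (x t))\<^sup>2"]
      \<open>\<not> I \<ge> 0\<close> by simp
qed

theorem theorem15:
  fixes A :: "real ^ 'm ^ 'm" and B :: "real ^ 'n ^ 'm"
    and C :: "real ^ 'm ^ 'n" and D :: "real ^ 'n ^ 'n"
    and R :: "real ^ 'm ^ 'm" and M :: "real ^ ('m + 'n) ^ ('m + 'n)"
    and U :: "(real \<Rightarrow> real ^ 'n) set" and Q :: "real ^ 2 ^ 2"
  assumes "symmetric_matrix M" and "symmetric_matrix Q"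
    and "U \<subseteq> L2_signals"
    and "\<And>u. u \<in> U \<Longrightarrow> \<exists>x y. reset_solution A B C D R M u x y"
    and "\<And>u x y. u \<in> U \<Longrightarrow> reset_solution A B C D R M u x y \<Longrightarrow>
           x \<in> L2_signals \<and> y \<in> L2_signals"
    and "\<And>y. y \<in> reset_outputs A B C D R M (\<lambda>t. 0) \<Longrightarrow> L2_zero y"
    and "\<exists>\<tau>\<^sub>1\<ge>0. \<exists>\<tau>\<^sub>2\<ge>0. \<exists>P :: real ^ 'm ^ 'm. symmetric_matrix P \<and>
           neg_semidef
             (transpose (block_mat A B (mat 1) 0) ** block_mat 0 P P 0 ** block_mat A B (mat 1) 0
               - Theta_mat C D Q + \<tau>\<^sub>1 *\<^sub>R M) \<and>
           neg_semidef
             (block_mat (transpose R ** P ** R - P) 0 0 (0 :: real ^ 'n ^ 'n) - \<tau>\<^sub>2 *\<^sub>R M)"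
  shows "scaled_graph U (reset_outputs A B C D R M) \<subseteq> S_region Q"
proof (rule scaled_graph_subset_S_region)
  fix u y assume u: "u \<in> U" and "y \<in> reset_outputs A B C D R M u"
  then obtain x where sol: "reset_solution A B C D R M u x y"
    by (auto simp: reset_outputs_def)
  have L2: "u \<in> L2_signals" "x \<in> L2_signals" "y \<in> L2_signals"
    using assms(3) assms(5)[OF u sol] u by auto
  then show "u \<in> L2_signals \<and> y \<in> L2_signals" by simp
  from assms(7) obtain \<tau>\<^sub>1 \<tau>\<^sub>2 and P :: "real ^ 'm ^ 'm" where \<tau>: "\<tau>\<^sub>1 \<ge> 0" "\<tau>\<^sub>2 \<ge> 0"
    and LMI: "neg_semidef
             (transpose (block_mat A B (mat 1) 0) ** block_mat 0 P P 0 ** block_mat A B (mat 1) 0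
               - Theta_mat C D Q + \<tau>\<^sub>1 *\<^sub>R M)"
      "neg_semidef
             (block_mat (transpose R ** P ** R - P) 0 0 (0 :: real ^ 'n ^ 'n) - \<tau>\<^sub>2 *\<^sub>R M)"
    by auto
  define s where "s t = Q $ 1 $ 1 * (y t \<bullet> y t) + (Q $ 1 $ 2 + Q $ 2 $ 1) * (u t \<bullet> y t)
      + Q $ 2 $ 2 * (u t \<bullet> u t)" for t
  note [simp] = L2_inner_integrable[OF L2(1,1)] L2_inner_integrable[OF L2(1,3)]
    L2_inner_integrable[OF L2(3,3)]
  have s: "integrable half_line s" unfolding s_def by simp
  have "s integrable_on {0..t}" for t
    by (rule set_lebesgue_integral_eq_integral(1),
        rule set_integrable_subset[OF set_integrable_half_line[OF s]]) auto
  then have "x t \<bullet> (P *v x t) \<le> integral {0..t} s" if "t \<ge> 0" for t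
    using reset_solution_dissipation[OF sol \<tau> LMI _ that] unfolding s_def by blast
  \<comment> \<open>Here \<open>J t\<close> is the supply up to time \<open>t\<close>, and its limit
    is the total supply.\<close>
  then have "0 \<le> integral\<^sup>L half_line s"
    by (rule L2_storage_limit_nonneg[OF L2(2) _ tendsto_integral_half_line[OF s]])
  also have "integral\<^sup>L half_line s = Q $ 1 $ 1 * L2_inner y y + (Q $ 1 $ 2 + Q $ 2 $ 1) * L2_inner u y
      + Q $ 2 $ 2 * L2_inner u u"
    unfolding s_def L2_inner_def by simp
  finally show "0 \<le> Q $ 1 $ 1 * L2_inner y y + (Q $ 1 $ 2 + Q $ 2 $ 1) * L2_inner u y
      + Q $ 2 $ 2 * L2_inner u u" .
qed

end
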